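(* Let $d\ge 1$, let $m\in\mathbb N$, let $\{X_{\mathbf n}:\mathbf n\in\mathbb Z^d\}$ be a stationary $m$-dependent random field, let $\preccurlyeq$ be a translation invariant total order on $\mathbb Z^d$, and let $\{\mathbf N(n)\}\subset\mathbb N^d$ satisfy $N_l(n)\to\infty$ for every $l\in\{1,\dots,d\}$ and $N_1(n)N_2(n)\cdots N_d(n)\sim n^d$. Let $\{v_n\}\subset\mathbb R$ be such that $$\liminf_{n\to\infty}\mathbb P\left(M_{\mathbf N(n)}\le v_n\right)>0.$$ Then $$\mathbb P\left(M_{\mathbf N(n)}\le v_n\right)=\exp\left(-n^d\,\mathbb P\left(X_{\mathbf 0}>v_n,\ M_{A((m,m,\dots,m))}\le v_n\right)\right)+o(1)\qquad (n\to\infty).$$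
   Context: Stationary means that the finite-dimensional distributions are invariant under all translations of $\mathbb Z^d$. $\mathbb N$ denotes the nonnegative integers. The field $\{X_{\mathbf n}\}$ is $m$-dependent if the families $\{X_{\mathbf i}:\mathbf i\in U\}$ and $\{X_{\mathbf j}:\mathbf j\in V\}$ are independent for all pairs of finite sets $U,V\subset\mathbb Z^d$ with $\min\{\|\mathbf i-\mathbf j\|:\mathbf i\in U,\mathbf j\in V\}>m$, where $\|\cdot\|$ is the sup norm. Inequalities $\mathbf i\le\mathbf j$ between elements of $\mathbb Z^d$ are coordinatewise; $\mathbf 0=(0,\dots,0)$, $\mathbf 1=(1,\dots,1)$. For finite $A\subset\mathbb Z^d$, $M_A:=\sup\{X_{\mathbf i}:\mathbf i\in A\}$ (with $\sup\emptyset=-\infty$), and for $\mathbf n\in\mathbb N^d$, $M_{\mathbf n}:=\sup\{X_{\mathbf i}:\mathbf 1\le\mathbf i\le\mathbf n\}$. A total order $\preccurlyeq$ on $\mathbb Z^d$ is translation invariant if $\mathbf i\preccurlyeq\mathbf j$ implies $\mathbf i+\mathbf k\preccurlyeq\mathbf j+\mathbf k$ for all $\mathbf k\in\mathbb Z^d$; $\mathbf i\prec\mathbf j$ means $\mathbf i\preccurlyeq\mathbf j$ and $\mathbf i\ne\mathbf j$. For $\mathbf p\in\mathbb N^d$, $$A(\mathbf p):=\{\mathbf j\in\mathbb Z^d:\ -\mathbf p\le\mathbf j\le\mathbf p\text{ and }\mathbf 0\prec\mathbf j\}.$$ *)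

theory Defs
  imports "HOL-Probability.Probability" "HOL-Library.Landau_Symbols"
begin

text \<open>
  The index set of a field is the type \<open>int ^ 'd\<close>, i.e. \<open>d = CARD('d)\<close>, with the library's
  coordinatewise order and group operations.
\<close>

definition sup_norm :: "int ^ 'd \<Rightarrow> int" where
  "sup_norm i = (MAX l. \<bar>i $ l\<bar>)"

definition int_vec :: "nat ^ 'd \<Rightarrow> int ^ 'd" where
  "int_vec p = (\<chi> l. int (p $ l))"

definition random_field :: "'a measure \<Rightarrow> (int ^ 'd \<Rightarrow> 'a \<Rightarrow> real) \<Rightarrow> bool" where
  "random_field M X \<longleftrightarrow> prob_space M \<and> (\<forall>i. X i \<in> borel_measurable M)"

definition stationary :: "'a measure \<Rightarrow> (int ^ 'd \<Rightarrow> 'a \<Rightarrow> real) \<Rightarrow> bool" where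
  "stationary M X \<longleftrightarrow>
    (\<forall>J k. finite J \<longrightarrow>
      distr M (\<Pi>\<^sub>M j\<in>J. borel) (\<lambda>\<omega>. \<lambda>j\<in>J. X (j + k) \<omega>) =
      distr M (\<Pi>\<^sub>M j\<in>J. borel) (\<lambda>\<omega>. \<lambda>j\<in>J. X j \<omega>))"

definition m_dependent :: "'a measure \<Rightarrow> nat \<Rightarrow> (int ^ 'd \<Rightarrow> 'a \<Rightarrow> real) \<Rightarrow> bool" where
  "m_dependent M m X \<longleftrightarrow>
    (\<forall>U V. finite U \<longrightarrow> finite V \<longrightarrow> (\<forall>i\<in>U. \<forall>j\<in>V. sup_norm (i - j) > int m) \<longrightarrow>
      prob_space.indep_var M
        (\<Pi>\<^sub>M i\<in>U. borel) (\<lambda>\<omega>. \<lambda>i\<in>U. X i \<omega>)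
        (\<Pi>\<^sub>M j\<in>V. borel) (\<lambda>\<omega>. \<lambda>j\<in>V. X j \<omega>))"

text \<open>Extended-real valued, so that the maximum over the empty set is \<open>-\<infinity>\<close>.\<close>

definition field_max :: "(int ^ 'd \<Rightarrow> 'a \<Rightarrow> real) \<Rightarrow> (int ^ 'd) set \<Rightarrow> 'a \<Rightarrow> ereal" where
  "field_max X A \<omega> = (SUP i\<in>A. ereal (X i \<omega>))"

definition box_max :: "(int ^ 'd \<Rightarrow> 'a \<Rightarrow> real) \<Rightarrow> nat ^ 'd \<Rightarrow> 'a \<Rightarrow> ereal" where
  "box_max X n = field_max X {1..int_vec n}"

definition translation_invariant :: "(int ^ 'd) rel \<Rightarrow> bool" where
  "translation_invariant r \<longleftrightarrow> (\<forall>i j k. (i, j) \<in> r \<longrightarrow> (i + k, j + k) \<in> r)"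

definition A_set :: "(int ^ 'd) rel \<Rightarrow> nat ^ 'd \<Rightarrow> (int ^ 'd) set" where
  "A_set r p = {j. - int_vec p \<le> j \<and> j \<le> int_vec p \<and> (0, j) \<in> r \<and> 0 \<noteq> j}"

end

theory Submission
  imports Defs "HOL-Real_Asymp.Real_Asymp"
begin

text \<open>
  Let \<open>q = P(X\<^sub>0 > v)\<close> and \<open>\<beta> = P(X\<^sub>0 > v, M\<^sub>A \<le> v)\<close> with \<open>A = A(m,\<dots>,m)\<close>, and peel off the points
  of the box \<open>T\<close> one at a time, always removing the least point \<open>i\<close> of what is left. The removed point
  lies below the remaining set \<open>S\<close>, so \<open>S\<close> meets its \<open>m\<close>-neighbourhood exactly in \<open>i + A\<close>, unless \<open>i\<close>
  is near the boundary of the box. Discarding the points of \<open>S\<close> at distance between \<open>m\<close> and \<open>2m\<close> from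
  \<open>i\<close> decouples \<open>i + A\<close> from the rest at a cost of order \<open>q\<^sup>2\<close>, since it matters only if two
  independent exceedances occur. Hence each step multiplies the probability of no exceedance by
  \<open>1 - \<beta>\<close> up to \<open>O(q\<^sup>2)\<close>, or \<open>O(q)\<close> at the boundary, and the total error is
  \<open>O(|T| q\<^sup>2 + |\<partial>T| q)\<close>. This vanishes because \<open>|T| q\<close> is bounded: a subset of \<open>T\<close> of proportional
  size consists of points more than \<open>m\<close> apart, along which the field is independent, so an unbounded
  \<open>|T| q\<close> would force the probability of no exceedance to \<open>0\<close>.
\<close>

section \<open>Sup-norm balls and boxes in the integer lattice\<close>

lemma sup_norm_le_iff: "sup_norm i \<le> c \<longleftrightarrow> (\<forall>l. \<bar>i $ l\<bar> \<le> c)"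
  unfolding sup_norm_def by (subst Max_le_iff) auto

lemma sup_norm_le_interval:
  fixes i :: "int ^ 'd"
  shows "sup_norm i \<le> c \<longleftrightarrow> i \<in> {- vec c..vec c}"
  unfolding sup_norm_le_iff by (auto simp: less_eq_vec_def abs_le_iff minus_le_iff)

lemma sup_norm_add_le: "sup_norm (i + j) \<le> sup_norm i + sup_norm j"
proof -
  have "\<bar>i $ l\<bar> \<le> sup_norm i" "\<bar>j $ l\<bar> \<le> sup_norm j" for l
    using sup_norm_le_iff[of i "sup_norm i"] sup_norm_le_iff[of j "sup_norm j"] by auto
  then show ?thesis
    unfolding sup_norm_le_iff by (smt (verit, best) vector_add_component)
qed

lemma sup_norm_minus: "sup_norm (- i) = sup_norm i"
  by (simp add: sup_norm_def)

lemma sup_norm_minus_commute: "sup_norm (i - j) = sup_norm (j - i)"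
  using sup_norm_minus[of "i - j"] by simp

text \<open>Reduces finiteness and counting of boxes to products of integer intervals, one per
  coordinate.\<close>

lemma bij_betw_vec_interval:
  fixes a b :: "int ^ 'd"
  shows "bij_betw vec_nth {a..b} (PiE UNIV (\<lambda>l. {a $ l..b $ l}))"
proof (rule bij_betwI[where g = vec_lambda])
  show "vec_nth \<in> {a..b} \<rightarrow> (\<Pi>\<^sub>E l\<in>UNIV. {a $ l..b $ l})"
    by (auto simp: less_eq_vec_def)
  show "vec_lambda \<in> (\<Pi>\<^sub>E l\<in>UNIV. {a $ l..b $ l}) \<rightarrow> {a..b}"
    by (auto simp: less_eq_vec_def PiE_iff)
qed auto

lemma finite_vec_interval: "finite {a..b :: int ^ 'd}"
  using bij_betw_finite[OF bij_betw_vec_interval[of a b]] by (simp add: finite_PiE)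

lemma card_vec_interval: "card {a..b :: int ^ 'd} = (\<Prod>l\<in>UNIV. nat (b $ l - a $ l + 1))"
  using bij_betw_same_card[OF bij_betw_vec_interval[of a b]]
  by (simp add: card_PiE)

text \<open>Used with radius \<open>m\<close>, the range of dependence, and with radius
  \<open>2 * m\<close>, beyond which a site is decoupled from the whole ball of radius
  \<open>m\<close>.\<close>

definition neighbourhood :: "nat \<Rightarrow> int ^ 'd \<Rightarrow> (int ^ 'd) set" where
  "neighbourhood c i = {j. sup_norm (j - i) \<le> int c}"

lemma neighbourhood_eq_image: "neighbourhood c i = (+) i ` {- vec (int c)..vec (int c)}"
  unfolding neighbourhood_def sup_norm_le_interval
  by (force simp: image_iff intro: exI[of _ "_ - i"])

lemma finite_neighbourhood: "finite (neighbourhood c i)"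
  unfolding neighbourhood_eq_image by (simp add: finite_vec_interval)

lemma card_neighbourhood: "card (neighbourhood c i) = card (neighbourhood c (0 :: int ^ 'd))"
  for i :: "int ^ 'd"
  unfolding neighbourhood_eq_image by (simp add: card_image)

lemma neighbourhood_self: "i \<in> neighbourhood c i"
  by (simp add: neighbourhood_def sup_norm_le_iff)

lemma card_neighbourhood_pos: "0 < card (neighbourhood c i)"
  using finite_neighbourhood neighbourhood_self by (metis card_gt_0_iff empty_iff)

text \<open>The triangle inequality in the form needed for decoupling: with
  \<open>a = b = m\<close>, a site outside the \<open>2 * m\<close>-ball around \<open>i\<close> is
  more than \<open>m\<close> away from every site of the \<open>m\<close>-ball.\<close>

lemma sup_norm_diff_gt:
  assumes "sup_norm (k - i) > int (a + b)" and "sup_norm (j - i) \<le> int a"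
  shows "sup_norm (j - k) > int b"
  using sup_norm_add_le[of "k - j" "j - i"] assms sup_norm_minus_commute[of j k]
  by simp

lemma A_set_vec:
  fixes r :: "(int ^ 'd) rel"
  shows "A_set r (vec m) = {j. sup_norm j \<le> int m \<and> (0, j) \<in> r \<and> j \<noteq> 0}"
proof -
  have "int_vec (vec m) = (vec (int m) :: int ^ 'd)" by (simp add: int_vec_def vec_eq_iff)
  then show ?thesis unfolding A_set_def sup_norm_le_interval by auto
qed

lemma finite_A_set: "finite (A_set r p)"
  by (rule finite_subset[OF _ finite_vec_interval[of "- int_vec p" "int_vec p"]])
    (auto simp: A_set_def)

lemma field_max_le_iff: "field_max X A \<omega> \<le> ereal c \<longleftrightarrow> (\<forall>i\<in>A. X i \<omega> \<le> c)"
  by (auto simp: field_max_def SUP_le_iff)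

section \<open>Exceedance events of a stationary m-dependent field\<close>

locale stationary_m_dependent_field =
  fixes M :: "'a measure" and X :: "int ^ 'd \<Rightarrow> 'a \<Rightarrow> real" and m :: nat
  assumes random_field: "random_field M X"
    and stationary: "stationary M X"
    and m_dependent: "m_dependent M m X"
begin

sublocale prob_space M
  using random_field by (simp add: random_field_def)

lemma X_measurable [measurable]: "X i \<in> borel_measurable M"
  using random_field by (simp add: random_field_def)

text \<open>Two index sets make one notion serve for all probabilities involved:
  \<open>U = {}\<close> gives the event of no exceedance in \<open>W\<close>, and
  \<open>U = {0}\<close> with \<open>W = A\<close> gives the event whose probability is
  \<beta>.\<close>

definition exceed_event :: "real \<Rightarrow> (int ^ 'd) set \<Rightarrow> (int ^ 'd) set \<Rightarrow> 'a set" where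
  "exceed_event c U W = {\<omega> \<in> space M. (\<forall>i\<in>U. X i \<omega> > c) \<and> (\<forall>j\<in>W. X j \<omega> \<le> c)}"

definition tail :: "real \<Rightarrow> real" where
  "tail c = prob (exceed_event c {0} {})"

lemma exceed_event_sets [measurable]:
  assumes "finite U" "finite W"
  shows "exceed_event c U W \<in> events"
  unfolding exceed_event_def using assms by measurable

text \<open>The same event as a set in the coordinate space over \<open>J\<close>; stationarity and
  m-dependence speak of finite random vectors, so they apply to preimages of such sets.\<close>

definition exceed_cylinder ::
    "real \<Rightarrow> (int ^ 'd) set \<Rightarrow> (int ^ 'd) set \<Rightarrow> (int ^ 'd) set \<Rightarrow> (int ^ 'd \<Rightarrow> real) set" where
  "exceed_cylinder c U W J =
    {f \<in> space (\<Pi>\<^sub>M j\<in>J. borel). (\<forall>i\<in>U. f i > c) \<and> (\<forall>j\<in>W. f j \<le> c)}"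

lemma exceed_cylinder_sets:
  assumes "finite J" "U \<subseteq> J" "W \<subseteq> J"
  shows "exceed_cylinder c U W J \<in> sets (\<Pi>\<^sub>M j\<in>J. borel)"
proof -
  have "finite U" "finite W" using assms finite_subset by auto
  moreover have "(\<lambda>f. f i) \<in> borel_measurable (\<Pi>\<^sub>M j\<in>J. (borel :: real measure))"
    if "i \<in> J" for i using that by measurable
  ultimately show ?thesis
    unfolding exceed_cylinder_def using assms
    by (intro sets.sets_Collect_conj sets.sets_Collect_finite_All borel_measurable_less
        borel_measurable_le) (auto simp: subset_iff intro: borel_measurable_less borel_measurable_le)
qed

lemma prob_exceed_event_translate:
  assumes "finite U" "finite W"
  shows "prob (exceed_event c ((\<lambda>j. j + k) ` U) ((\<lambda>j. j + k) ` W)) = prob (exceed_event c U W)"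
proof -
  let ?J = "U \<union> W"
  let ?P = "\<Pi>\<^sub>M j\<in>?J. (borel :: real measure)"
  let ?C = "exceed_cylinder c U W ?J"
  have C: "?C \<in> sets ?P" using assms by (intro exceed_cylinder_sets) auto
  have meas: "(\<lambda>\<omega>. \<lambda>j\<in>?J. X (g j) \<omega>) \<in> measurable M ?P" for g
    by measurable
  have "prob (exceed_event c ((\<lambda>j. j + k) ` U) ((\<lambda>j. j + k) ` W))
      = measure (distr M ?P (\<lambda>\<omega>. \<lambda>j\<in>?J. X (j + k) \<omega>)) ?C"
    by (subst measure_distr[OF meas[of "\<lambda>j. j + k"] C], rule arg_cong[where f = prob])
      (auto simp: exceed_event_def exceed_cylinder_def space_PiM)
  also have "\<dots> = measure (distr M ?P (\<lambda>\<omega>. \<lambda>j\<in>?J. X j \<omega>)) ?C"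
    using stationary[unfolded stationary_def, rule_format, of ?J k] assms by simp
  also have "\<dots> = prob (exceed_event c U W)"
    by (subst measure_distr[OF meas[of "\<lambda>j. j"] C], rule arg_cong[where f = prob])
      (auto simp: exceed_event_def exceed_cylinder_def space_PiM)
  finally show ?thesis .
qed

lemma prob_exceed_event_indep:
  assumes fin: "finite U" "finite W" "finite U'" "finite W'"
    and sep: "\<And>i j. i \<in> U \<union> W \<Longrightarrow> j \<in> U' \<union> W' \<Longrightarrow> sup_norm (i - j) > int m"
  shows "prob (exceed_event c (U \<union> U') (W \<union> W')) =
    prob (exceed_event c U W) * prob (exceed_event c U' W')"
proof -
  let ?J = "U \<union> W" and ?K = "U' \<union> W'"
  let ?F = "\<lambda>J \<omega>. \<lambda>j\<in>J. X j \<omega>"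
  have indep: "indep_var (\<Pi>\<^sub>M i\<in>?J. borel) (?F ?J) (\<Pi>\<^sub>M i\<in>?K. borel) (?F ?K)"
    by (rule m_dependent[unfolded m_dependent_def, rule_format]) (use fin sep in auto)
  have C: "exceed_cylinder c U W ?J \<in> sets (\<Pi>\<^sub>M i\<in>?J. borel)"
    "exceed_cylinder c U' W' ?K \<in> sets (\<Pi>\<^sub>M i\<in>?K. borel)"
    using fin by (auto intro!: exceed_cylinder_sets)
  have e: "?F J -` exceed_cylinder c A B J \<inter> space M = exceed_event c A B"
    if "J = A \<union> B" for A B J
    using that by (auto simp: exceed_event_def exceed_cylinder_def space_PiM)
  have e': "(\<lambda>\<omega>. (?F ?J \<omega>, ?F ?K \<omega>)) -` (exceed_cylinder c U W ?J \<times> exceed_cylinder c U' W' ?K)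
      \<inter> space M = exceed_event c (U \<union> U') (W \<union> W')"
    by (auto simp: exceed_event_def exceed_cylinder_def space_PiM)
  show ?thesis
    using indep_varD[OF indep C] by (simp only: e' e)
qed

lemma prob_exceed_event_single: "prob (exceed_event c {i} {}) = tail c"
  using prob_exceed_event_translate[of "{0}" "{}" c i] by (simp add: tail_def)

lemma exceed_event_mono:
  "U' \<subseteq> U \<Longrightarrow> W' \<subseteq> W \<Longrightarrow> exceed_event c U W \<subseteq> exceed_event c U' W'"
  by (auto simp: exceed_event_def)

lemma prob_exceed_event_mono:
  assumes "U' \<subseteq> U" "W' \<subseteq> W" "finite U" "finite W"
  shows "prob (exceed_event c U W) \<le> prob (exceed_event c U' W')"
  using assms finite_subset[OF assms(1,3)] finite_subset[OF assms(2,4)]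
  by (intro finite_measure_mono exceed_event_mono exceed_event_sets)

lemma tail_bounds: "0 \<le> tail c" "tail c \<le> 1"
  by (simp_all add: tail_def)

text \<open>Splits according to whether the field exceeds \<open>c\<close> at \<open>i\<close>. This
  is the identity behind peeling off one site and behind the union bound that follows.\<close>

lemma prob_exceed_event_insert:
  assumes "finite U" "finite W"
  shows "prob (exceed_event c U (insert i W)) =
    prob (exceed_event c U W) - prob (exceed_event c (insert i U) W)"
proof -
  have "exceed_event c U W = exceed_event c U (insert i W) \<union> exceed_event c (insert i U) W"
    by (auto simp: exceed_event_def not_le)
  moreover have "exceed_event c U (insert i W) \<inter> exceed_event c (insert i U) W = {}"
    by (auto simp: exceed_event_def)
  ultimately have "prob (exceed_event c U W) =
      prob (exceed_event c U (insert i W)) + prob (exceed_event c (insert i U) W)"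
    using finite_measure_Union[of "exceed_event c U (insert i W)" "exceed_event c (insert i U) W"]
      exceed_event_sets assms by simp
  then show ?thesis by simp
qed

text \<open>A union bound: dropping the constraints on \<open>V\<close> matters only if some site of
  \<open>V\<close> exceeds \<open>c\<close> together with all of \<open>U\<close>. Membership in an
  interval records the sign of the error along with its size.\<close>

lemma prob_exceed_event_Un:
  assumes "finite U" "finite W" "finite V"
  shows "prob (exceed_event c U W) - prob (exceed_event c U (W \<union> V)) \<in>
    {0..(\<Sum>j\<in>V. prob (exceed_event c (insert j U) {}))}"
  using assms(3)
proof induction
  case empty
  then show ?case by simp
next
  case (insert j V)
  have "prob (exceed_event c U (W \<union> insert j V)) =
      prob (exceed_event c U (W \<union> V)) - prob (exceed_event c (insert j U) (W \<union> V))"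
    using prob_exceed_event_insert[of U "W \<union> V" c j] assms insert by simp
  moreover have "prob (exceed_event c (insert j U) (W \<union> V)) \<le> prob (exceed_event c (insert j U) {})"
    using assms insert by (intro prob_exceed_event_mono) auto
  moreover have "0 \<le> prob (exceed_event c (insert j U) (W \<union> V))"
    by simp
  ultimately show ?case using insert unfolding atLeastAtMost_iff sum.insert[OF insert(1,2)]
    by linarith
qed

section \<open>Separated sites and boundedness of the expected number of exceedances\<close>

lemma prob_exceed_event_pair:
  assumes "sup_norm (i - j) > int m"
  shows "prob (exceed_event c {i, j} {}) = tail c ^ 2"
  using prob_exceed_event_indep[of "{i}" "{}" "{j}" "{}" c] assms
  by (simp add: prob_exceed_event_single power2_eq_square insert_commute)

text \<open>Greedy choice of separated sites: each chosen site costs at most one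
  \<open>m\<close>-neighbourhood of \<open>T\<close>, and what is left is independent of it, so
  every choice contributes a factor \<open>1 - tail c\<close>.\<close>

lemma prob_no_exceed_le_power:
  assumes "finite T" and "k * card (neighbourhood m (0 :: int ^ 'd)) \<le> card T"
  shows "prob (exceed_event c {} T) \<le> (1 - tail c) ^ k"
  using assms
proof (induction k arbitrary: T)
  case 0
  then show ?case by simp
next
  case (Suc k)
  let ?C = "card (neighbourhood m (0 :: int ^ 'd))"
  have "T \<noteq> {}" using Suc.prems card_neighbourhood_pos[of m "0 :: int ^ 'd"] by auto
  then obtain i where i: "i \<in> T" by blast
  define S where "S = T - neighbourhood m i"
  have S: "finite S" "S \<subseteq> T" using Suc.prems by (auto simp: S_def)
  have "card T - card (neighbourhood m i) \<le> card S"
    unfolding S_def by (rule diff_card_le_card_Diff[OF finite_neighbourhood])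
  then have "k * ?C \<le> card S"
    using Suc.prems card_neighbourhood[of m i] by simp
  then have IH: "prob (exceed_event c {} S) \<le> (1 - tail c) ^ k" using Suc.IH S by blast
  have "prob (exceed_event c {} T) \<le> prob (exceed_event c {} (insert i S))"
    using Suc.prems i S by (intro prob_exceed_event_mono) auto
  also have "\<dots> = prob (exceed_event c {} {i}) * prob (exceed_event c {} S)"
    using prob_exceed_event_indep[of "{}" "{i}" "{}" S c] S
    by (auto simp: S_def neighbourhood_def sup_norm_minus_commute[of i] not_le)
  also have "prob (exceed_event c {} {i}) = 1 - tail c"
    using prob_exceed_event_insert[of "{}" "{}" c i] prob_exceed_event_single[of c i]
    by (simp add: exceed_event_def prob_space)
  also have "(1 - tail c) * prob (exceed_event c {} S) \<le> (1 - tail c) ^ Suc k"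
    using IH tail_bounds[of c] by (simp add: mult_left_mono)
  finally show ?case .
qed

text \<open>With \<open>k = card T div C\<close> separated sites,
  \<open>a \<le> (1 - tail c) ^ k \<le> exp (- k * tail c)\<close>, hence
  \<open>k * tail c \<le> - ln a\<close>. The remainder of the division costs at most one more
  \<open>tail c \<le> 1\<close>, which is the \<open>1\<close> in \<open>1 - ln a\<close>.\<close>

lemma card_tail_le:
  assumes "finite T" and "0 < a" and "a \<le> prob (exceed_event c {} T)"
  shows "real (card T) * tail c \<le> real (card (neighbourhood m (0 :: int ^ 'd))) * (1 - ln a)"
proof -
  define C where "C = card (neighbourhood m (0 :: int ^ 'd))"
  define k where "k = card T div C"
  have C: "C > 0" unfolding C_def by (rule card_neighbourhood_pos)
  have "a \<le> (1 - tail c) ^ k"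
    using prob_no_exceed_le_power[OF assms(1), of k c] assms(3) by (simp add: k_def C_def)
  also have "\<dots> \<le> exp (- tail c) ^ k"
    using tail_bounds[of c] exp_ge_add_one_self[of "- tail c"] by (intro power_mono) auto
  also have "\<dots> = exp (- (real k * tail c))" by (simp add: exp_of_nat_mult[symmetric])
  finally have "ln a \<le> ln (exp (- (real k * tail c)))"
    using \<open>0 < a\<close> by (subst ln_le_cancel_iff) auto
  then have ln_a: "ln a \<le> - (real k * tail c)" by simp
  have "card T \<le> C * (k + 1)"
    unfolding k_def using C 
    by (metis Suc_eq_plus1 dividend_less_times_div less_imp_le mult_Suc_right)
  then have "real (card T) \<le> real (C * (k + 1))" by (simp only: of_nat_le_iff)
  then have "real (card T) \<le> real C * (real k + 1)" by (simp add: algebra_simps)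
  then have "real (card T) * tail c \<le> real C * (real k + 1) * tail c"
    using tail_bounds by (intro mult_right_mono)
  also have "\<dots> = real C * (real k * tail c + tail c)"
    by (simp add: algebra_simps)
  also have "\<dots> \<le> real C * (1 - ln a)"
    using tail_bounds[of c] ln_a by (intro mult_left_mono) auto
  finally show ?thesis by (simp add: C_def)
qed

section \<open>Peeling off sites one at a time\<close>

text \<open>Removing \<open>i\<close> loses the probability that \<open>i\<close> exceeds and
  \<open>S\<close> does not. Without the shell \<open>S2\<close> this factors into \<beta> times the
  probability of no exceedance in \<open>S3\<close>, and \<open>S3\<close> is then replaced by
  \<open>S\<close>. Each of the two replacements costs at most \<open>C * q ^ 2\<close>.\<close>

lemma prob_no_exceed_step:
  assumes S: "finite S"
    and beta: "prob (exceed_event c {i} (S \<inter> neighbourhood m i)) = \<beta>"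
  shows "\<bar>prob (exceed_event c {} (insert i S)) - (1 - \<beta>) * prob (exceed_event c {} S)\<bar>
    \<le> 2 * real (card (neighbourhood (2 * m) (0 :: int ^ 'd))) * tail c ^ 2"
proof -
  let ?B = "neighbourhood (2 * m) i"
  define q where "q = tail c"
  define C where "C = real (card (neighbourhood (2 * m) (0 :: int ^ 'd)))"
  define S1 where "S1 = S \<inter> neighbourhood m i"
  define S2 where "S2 = S \<inter> ?B - neighbourhood m i"
  define S3 where "S3 = S - ?B"
  have fin: "finite S1" "finite S2" "finite S3" using S by (auto simp: S1_def S2_def S3_def)
  have split: "S = S1 \<union> S3 \<union> S2" "S = S3 \<union> S \<inter> ?B"
    by (auto simp: S1_def S2_def S3_def neighbourhood_def)
  have card_le: "real (card A) \<le> C" if "A \<subseteq> ?B" for A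
    using card_mono[OF finite_neighbourhood that] card_neighbourhood[of "2 * m" i] by (simp add: C_def)
  have q: "0 \<le> q" "q \<le> 1" using tail_bounds by (auto simp: q_def)
  \<comment> \<open>Sites of the shell are more than \<open>m\<close> away from \<open>i\<close>, so
    exceeding at both is a product of two independent events.\<close>
  have "prob (exceed_event c (insert j {i}) {}) = q ^ 2" if "j \<in> S2" for j
    using prob_exceed_event_pair[of j i c] that by (auto simp: S2_def neighbourhood_def q_def)
  then have "(\<Sum>j\<in>S2. prob (exceed_event c (insert j {i}) {})) = real (card S2) * q ^ 2" by simp
  also have "\<dots> \<le> C * q ^ 2" by (intro mult_right_mono card_le) (auto simp: S2_def)
  finally have near: "prob (exceed_event c {i} (S1 \<union> S3)) - prob (exceed_event c {i} S) \<in> {0..C * q ^ 2}"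
    using prob_exceed_event_Un[of "{i}" "S1 \<union> S3" S2 c] fin split(1) by auto
  \<comment> \<open>A bound of first order in \<open>q\<close> suffices here, because this
    difference is later multiplied by \<beta>, which is at most \<open>q\<close>.\<close>
  have "(\<Sum>j\<in>S \<inter> ?B. prob (exceed_event c (insert j {}) {})) = real (card (S \<inter> ?B)) * q"
    by (simp add: prob_exceed_event_single q_def)
  also have "\<dots> \<le> C * q" using q by (intro mult_right_mono card_le) auto
  finally have far: "prob (exceed_event c {} S3) - prob (exceed_event c {} S) \<in> {0..C * q}"
    using prob_exceed_event_Un[of "{}" S3 "S \<inter> ?B" c] fin S split(2) by auto
  have "prob (exceed_event c ({i} \<union> {}) (S1 \<union> S3)) =
      prob (exceed_event c {i} S1) * prob (exceed_event c {} S3)"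
  proof (rule prob_exceed_event_indep)
    fix j k assume "j \<in> {i} \<union> S1" "k \<in> {} \<union> S3"
    then have "j \<in> neighbourhood m i" "k \<notin> ?B"
      using neighbourhood_self by (auto simp: S1_def S3_def)
    then show "sup_norm (j - k) > int m"
      by (intro sup_norm_diff_gt[of m m k i j]) (auto simp: neighbourhood_def)
  qed (use fin in auto)
  then have prod: "prob (exceed_event c {i} (S1 \<union> S3)) = \<beta> * prob (exceed_event c {} S3)"
    using beta by (simp add: S1_def)
  have \<beta>: "0 \<le> \<beta>" "\<beta> \<le> q"
    using beta prob_exceed_event_mono[of "{i}" "{i}" "{}" S1 c] fin(1) prob_exceed_event_single[of c i]
    by (auto simp: S1_def q_def)
  have "\<beta> * (prob (exceed_event c {} S3) - prob (exceed_event c {} S)) \<le> q * (C * q)"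
    using far \<beta> q by (intro mult_mono) auto
  moreover have "0 \<le> \<beta> * (prob (exceed_event c {} S3) - prob (exceed_event c {} S))"
    using far \<beta> by auto
  moreover have "prob (exceed_event c {} (insert i S)) =
      prob (exceed_event c {} S) - prob (exceed_event c {i} S)"
    using prob_exceed_event_insert[of "{}" S c i] S by simp
  ultimately show ?thesis
    using near prod unfolding q_def[symmetric] C_def[symmetric]
    by (auto simp: algebra_simps power2_eq_square abs_le_iff)
qed

text \<open>Induction on the size of \<open>T\<close>, removing its least element. Earlier errors
  are not amplified, since they are multiplied by \<open>1 - \<beta>\<close>, which lies between 0
  and 1. The second term counts the sites whose translate of \<open>A\<close> leaves
  \<open>T\<close>; for these only a first-order bound is available.\<close>

lemma prob_no_exceed_approx:
  fixes c :: real
  assumes order: "linear_order r" and inv: "translation_invariant r" and "finite T"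
  defines "\<beta> \<equiv> prob (exceed_event c {0} (A_set r (vec m)))"
  shows "\<bar>prob (exceed_event c {} T) - (1 - \<beta>) ^ card T\<bar> \<le>
    2 * real (card (neighbourhood (2 * m) (0 :: int ^ 'd))) * real (card T) * tail c ^ 2
    + 2 * real (card {i \<in> T. \<not> (\<lambda>j. j + i) ` A_set r (vec m) \<subseteq> T}) * tail c"
  using \<open>finite T\<close>
proof (induction "card T" arbitrary: T)
  case 0
  then show ?case by (simp add: exceed_event_def prob_space)
next
  case (Suc n)
  define C where "C = real (card (neighbourhood (2 * m) (0 :: int ^ 'd)))"
  let ?A = "A_set r (vec m)"
  let ?bad = "\<lambda>T. {i \<in> T. \<not> (\<lambda>j. j + i) ` ?A \<subseteq> T}"
  have r: "refl r" "trans r" "antisym r" "total r"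
    using order unfolding linear_order_on_def partial_order_on_def preorder_on_def by auto
  have refl: "(i, i) \<in> r" for i using r(1) by (rule reflD)
  have trans: "(i, j) \<in> r \<Longrightarrow> (j, k) \<in> r \<Longrightarrow> (i, k) \<in> r" for i j k using r(2) by (rule transD)
  have antisym: "(i, j) \<in> r \<Longrightarrow> (j, i) \<in> r \<Longrightarrow> i = j" for i j using r(3) by (rule antisymD)
  have total: "(i, j) \<in> r \<or> (j, i) \<in> r" for i j
    using r(4) refl[of i] by (cases "i = j") (auto simp: total_on_def)
  have shift: "(0, j - i) \<in> r \<longleftrightarrow> (i, j) \<in> r" for i j
  proof
    assume "(0, j - i) \<in> r"
    then have "(0 + i, j - i + i) \<in> r" using inv unfolding translation_invariant_def by blast
    then show "(i, j) \<in> r" by simp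
  next
    assume "(i, j) \<in> r"
    then have "(i + - i, j + - i) \<in> r" using inv unfolding translation_invariant_def by blast
    then show "(0, j - i) \<in> r" by simp
  qed
  have least: "\<exists>i\<in>T. \<forall>j\<in>T. (i, j) \<in> r"
    if "finite T" "T \<noteq> {}" for T
    using that
  proof (induction rule: finite_ne_induct)
    case (singleton x)
    then show ?case using refl by simp
  next
    case (insert x F)
    then show ?case by (metis insert_iff refl total trans)
  qed
  have "T \<noteq> {}" using Suc.hyps(2) by auto
  then obtain i where i: "i \<in> T" "\<And>j. j \<in> T \<Longrightarrow> (i, j) \<in> r"
    using least[OF Suc.prems] by blast
  define S where "S = T - {i}"
  have S: "finite S" "i \<notin> S" "T = insert i S" "card S = n" using Suc.hyps(2) Suc.prems i(1) by (auto simp: S_def)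
  let ?p = "prob (exceed_event c {} S)"
  have q: "0 \<le> tail c" "tail c \<le> 1" by (rule tail_bounds)+
  have \<beta>: "0 \<le> \<beta>" "\<beta> \<le> tail c"
    using prob_exceed_event_mono[of "{0}" "{0}" "{}" ?A c] finite_A_set[of r "vec m"]
    by (auto simp: \<beta>_def tail_def)
  \<comment> \<open>Translates of \<open>A\<close> contain only sites above their base point, so the
    least site \<open>i\<close> lies in none of those based in \<open>S\<close>.\<close>
  have i_notin: "i \<notin> (\<lambda>k. k + j) ` ?A" if "j \<in> S" for j
  proof
    assume "i \<in> (\<lambda>k. k + j) ` ?A"
    then have "(0, i - j) \<in> r" by (auto simp: A_set_vec)
    then have "(j, i) \<in> r" by (simp add: shift)
    then show False using i(2)[of j] that antisym S by auto
  qed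
  have sub_S: "(\<lambda>k. k + j) ` ?A \<subseteq> S \<longleftrightarrow> (\<lambda>k. k + j) ` ?A \<subseteq> T" if "j \<in> S" for j
    unfolding S(3) by (rule subset_insert[OF i_notin[OF that], symmetric])
  have mem_S: "j \<in> S \<longleftrightarrow> j \<in> T \<and> j \<noteq> i" for j by (simp add: S_def)
  \<comment> \<open>Removing \<open>i\<close> thus creates no new bad sites. This is why the total
    error involves only the bad sites of the original \<open>T\<close>, and not those of every
    intermediate set.\<close>
  have bad_S: "?bad S = ?bad T - {i}"
  proof (rule set_eqI)
    fix j
    show "j \<in> ?bad S \<longleftrightarrow> j \<in> ?bad T - {i}"
      unfolding mem_Collect_eq Diff_iff singleton_iff using sub_S[of j] mem_S[of j] by argo
  qed
  have fin_bad: "finite (?bad T)" using Suc.prems by simp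
  \<comment> \<open>The difference of the two cardinalities is 1 or 0 according to whether
    \<open>i\<close> is bad, so these terms telescope along the induction.\<close>
  have step: "\<bar>prob (exceed_event c {} T) - (1 - \<beta>) * ?p\<bar> \<le>
      2 * C * tail c ^ 2 + 2 * (real (card (?bad T)) - real (card (?bad S))) * tail c"
  proof (cases "i \<in> ?bad T")
    case True
    then have cards: "real (card (?bad T)) - real (card (?bad S)) = 1"
      unfolding bad_S using card_Suc_Diff1[OF fin_bad True] by linarith
    have "prob (exceed_event c {} T) = ?p - prob (exceed_event c {i} S)"
      using prob_exceed_event_insert[of "{}" S c i] S by simp
    moreover have "prob (exceed_event c {i} S) \<le> tail c"
      using prob_exceed_event_mono[of "{i}" "{i}" "{}" S c] S prob_exceed_event_single[of c i] by auto
    moreover have "\<beta> * ?p \<le> tail c * 1" using \<beta> by (intro mult_mono) auto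
    moreover have "0 \<le> \<beta> * ?p" using \<beta> by simp
    moreover have "0 \<le> prob (exceed_event c {i} S)" by simp
    moreover have "(1 - \<beta>) * ?p = ?p - \<beta> * ?p" by (simp add: algebra_simps)
    ultimately have "\<bar>prob (exceed_event c {} T) - (1 - \<beta>) * ?p\<bar> \<le> 2 * tail c"
      using q(1) by linarith
    moreover have "0 \<le> 2 * C * tail c ^ 2" by (simp add: C_def)
    ultimately show ?thesis unfolding cards by simp
  next
    case False
    then have sub: "(\<lambda>j. j + i) ` ?A \<subseteq> T" using i by auto
    \<comment> \<open>Since \<open>i\<close> is least, all sites of \<open>S\<close> near
      \<open>i\<close> lie above it; since \<open>i\<close> is not bad, all of \<open>i + A\<close>
      is still present.\<close>
    have "S \<inter> neighbourhood m i = (\<lambda>j. j + i) ` ?A"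
    proof
      show "S \<inter> neighbourhood m i \<subseteq> (\<lambda>j. j + i) ` ?A"
      proof
        fix j assume "j \<in> S \<inter> neighbourhood m i"
        then have "j - i \<in> ?A" using i(2)[of j] S
          by (auto simp: A_set_vec neighbourhood_def shift)
        then show "j \<in> (\<lambda>j. j + i) ` ?A" by (metis diff_add_cancel image_eqI)
      qed
      show "(\<lambda>j. j + i) ` ?A \<subseteq> S \<inter> neighbourhood m i"
        using sub by (auto simp: S_def A_set_vec neighbourhood_def)
    qed
    then have "prob (exceed_event c {i} (S \<inter> neighbourhood m i)) = \<beta>"
      using prob_exceed_event_translate[of "{0}" ?A c i] finite_A_set[of r "vec m"]
      by (simp add: \<beta>_def)
    then have "\<bar>prob (exceed_event c {} T) - (1 - \<beta>) * ?p\<bar> \<le> 2 * C * tail c ^ 2"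
      using prob_no_exceed_step[OF S(1), of c i \<beta>] S(3) by (simp add: C_def)
    moreover have "?bad S = ?bad T" using bad_S False by auto
    ultimately show ?thesis by simp
  qed
  have "\<bar>?p - (1 - \<beta>) ^ n\<bar> \<le> 2 * C * real n * tail c ^ 2 + 2 * real (card (?bad S)) * tail c"
    using Suc.hyps(1)[of S] S by (simp add: C_def)
  moreover have "\<bar>(1 - \<beta>) * (?p - (1 - \<beta>) ^ n)\<bar> \<le> 1 * \<bar>?p - (1 - \<beta>) ^ n\<bar>"
    unfolding abs_mult using \<beta> q by (intro mult_right_mono) auto
  ultimately have rest: "\<bar>(1 - \<beta>) * (?p - (1 - \<beta>) ^ n)\<bar> \<le>
      2 * C * real n * tail c ^ 2 + 2 * real (card (?bad S)) * tail c" by simp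
  have "prob (exceed_event c {} T) - (1 - \<beta>) ^ card T =
      (prob (exceed_event c {} T) - (1 - \<beta>) * ?p) + (1 - \<beta>) * (?p - (1 - \<beta>) ^ n)"
    using Suc.hyps(2)[symmetric] by (simp add: algebra_simps)
  then have "\<bar>prob (exceed_event c {} T) - (1 - \<beta>) ^ card T\<bar> \<le>
      \<bar>prob (exceed_event c {} T) - (1 - \<beta>) * ?p\<bar> + \<bar>(1 - \<beta>) * (?p - (1 - \<beta>) ^ n)\<bar>"
    using abs_triangle_ineq by simp
  also have "\<dots> \<le>
      (2 * C * tail c ^ 2 + 2 * (real (card (?bad T)) - real (card (?bad S))) * tail c) +
      (2 * C * real n * tail c ^ 2 + 2 * real (card (?bad S)) * tail c)"
    by (rule add_mono[OF step rest])
  also have "\<dots> = 2 * C * real (card T) * tail c ^ 2 + 2 * real (card (?bad T)) * tail c"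
    using Suc.hyps(2)[symmetric] by (simp add: algebra_simps)
  finally show ?case by (simp add: C_def)
qed

end

section \<open>Elementary estimates for the exponential function\<close>

text \<open>For a single factor,
  \<open>1 - x \<le> exp (- x) \<le> 1 / (1 + x) \<le> 1 - x + x ^ 2\<close>. Powers of numbers in
  the unit interval differ by at most \<open>n\<close> times the difference of the bases.\<close>

lemma power_one_minus_approx_exp:
  fixes x :: real
  assumes "0 \<le> x" "x \<le> 1"
  shows "\<bar>(1 - x) ^ n - exp (- (real n * x))\<bar> \<le> real n * x ^ 2"
proof -
  have "exp (- x) * (1 + x) \<le> exp (- x) * exp x" by (intro mult_left_mono) auto
  then have "exp (- x) * (1 + x) \<le> 1" by (simp add: exp_minus)
  \<comment> \<open>The product equals \<open>1 + x ^ 3\<close>.\<close>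
  also have "1 \<le> (1 - x + x ^ 2) * (1 + x)"
    using assms by (simp add: algebra_simps power2_eq_square)
  finally have "exp (- x) \<le> 1 - x + x ^ 2"
    using assms by (metis add_pos_nonneg mult_le_cancel_right not_less zero_less_one)
  then have *: "\<bar>(1 - x) - exp (- x)\<bar> \<le> x ^ 2"
    using exp_ge_add_one_self[of "- x"] by auto
  have "norm ((1 - x) ^ n - exp (- x) ^ n) \<le> real n * norm ((1 - x) - exp (- x))"
    using assms by (intro norm_power_diff) auto
  also have "\<dots> \<le> real n * x ^ 2" using * by (intro mult_left_mono) auto
  finally show ?thesis by (simp add: exp_of_nat_mult[symmetric])
qed

lemma abs_exp_minus_diff_le:
  fixes x y :: real
  assumes "0 \<le> x" "0 \<le> y"
  shows "\<bar>exp (- x) - exp (- y)\<bar> \<le> \<bar>x - y\<bar>"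
proof -
  have *: "exp (- a) - exp (- b) \<le> \<bar>a - b\<bar>" if "0 \<le> a" "0 \<le> b" for a b :: real
  proof (cases "a \<le> b")
    case True
    have "exp (- a) - exp (- b) = exp (- a) * (1 - exp (- (b - a)))"
      by (simp add: algebra_simps exp_add[symmetric])
    also have "\<dots> \<le> 1 * (b - a)"
    proof (intro mult_mono)
      show "1 - exp (- (b - a)) \<le> b - a" using exp_ge_add_one_self[of "- (b - a)"] by linarith
    qed (use that True in auto)
    finally show ?thesis using True by simp
  next
    case False
    then have "exp (- a) \<le> exp (- b)" by simp
    then show ?thesis by linarith
  qed
  show ?thesis using *[OF assms] *[OF assms(2,1)] by (simp add: abs_le_iff abs_minus_commute)
qed

section \<open>Boundary sites of growing boxes\<close>

lemma card_box: "card {1..int_vec p} = (\<Prod>l\<in>UNIV. p $ l)"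
  by (simp add: card_vec_interval int_vec_def)

text \<open>Shrinking the box by \<open>m\<close> on every side leaves sites that cannot be moved
  out of it by a displacement from \<open>A\<close>, so bad sites lie outside the inner box.\<close>

lemma card_box_boundary_le:
  fixes p :: "nat ^ 'd"
  assumes "\<And>j. j \<in> A \<Longrightarrow> sup_norm j \<le> int m"
  shows "real (card {i \<in> {1..int_vec p}. \<not> (\<lambda>j. j + i) ` A \<subseteq> {1..int_vec p}})
    \<le> (\<Prod>l\<in>UNIV. real (p $ l)) - (\<Prod>l\<in>UNIV. real (p $ l - 2 * m))"
proof -
  let ?T = "{1..int_vec p}"
  let ?I = "{1 + vec (int m)..int_vec p - vec (int m)}"
  let ?B = "{i \<in> ?T. \<not> (\<lambda>j. j + i) ` A \<subseteq> ?T}"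
  have I: "i \<in> ?I \<longleftrightarrow> (\<forall>l. 1 + int m \<le> i $ l \<and> i $ l \<le> int (p $ l) - int m)" for i
    by (auto simp: less_eq_vec_def int_vec_def)
  have T: "i \<in> ?T \<longleftrightarrow> (\<forall>l. 1 \<le> i $ l \<and> i $ l \<le> int (p $ l))" for i
    by (auto simp: less_eq_vec_def int_vec_def)
  have inner: "j + i \<in> ?T" if "i \<in> ?I" "sup_norm j \<le> int m" for i j
    unfolding T
  proof
    fix l
    have "\<bar>j $ l\<bar> \<le> int m" using that(2) by (simp add: sup_norm_le_iff)
    moreover have "1 + int m \<le> i $ l" "i $ l \<le> int (p $ l) - int m" using that(1) unfolding I by auto
    ultimately show "1 \<le> (j + i) $ l \<and> (j + i) $ l \<le> int (p $ l)" by auto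
  qed
  have "sup_norm (0 :: int ^ 'd) \<le> int m" by (simp add: sup_norm_le_iff)
  then have sub: "?I \<subseteq> ?T" using inner[of _ 0] by auto
  have "?B \<subseteq> ?T - ?I" using inner assms by blast
  then have "card ?B \<le> card (?T - ?I)" by (intro card_mono finite_Diff finite_vec_interval)
  also have "\<dots> = card ?T - card ?I" by (rule card_Diff_subset[OF finite_vec_interval sub])
  finally have "real (card ?B) \<le> real (card ?T) - real (card ?I)"
    using card_mono[OF finite_vec_interval sub] by linarith
  \<comment> \<open>Truncated subtraction gives 0 for a side shorter than \<open>2 * m\<close>, in
    agreement with the inner box being empty.\<close>
  moreover have "card ?I = (\<Prod>l\<in>UNIV. p $ l - 2 * m)"
    unfolding card_vec_interval by (intro prod.cong) (auto simp: int_vec_def)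
  ultimately show ?thesis by (simp add: card_box)
qed

text \<open>The ratio is 1 minus a product over coordinates of \<open>(N - k) / N\<close>, and each
  of these finitely many factors tends to 1. With \<open>k = 2 * m\<close> it shows that the
  boundary is a vanishing fraction of the box.\<close>

lemma prod_diff_ratio_tendsto:
  fixes N :: "nat \<Rightarrow> nat ^ 'd"
  assumes "\<And>l. filterlim (\<lambda>n. N n $ l) at_top sequentially"
  shows "(\<lambda>n. ((\<Prod>l\<in>UNIV. real (N n $ l)) - (\<Prod>l\<in>UNIV. real (N n $ l - k))) /
    (\<Prod>l\<in>UNIV. real (N n $ l))) \<longlonglongrightarrow> 0"
proof -
  have "(\<lambda>x::nat. real (x - k) / real x) \<longlonglongrightarrow> 1"
  proof (rule Lim_transform_eventually)
    show "(\<lambda>x::nat. 1 - real k / real x) \<longlonglongrightarrow> 1" by real_asymp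
    show "\<forall>\<^sub>F x in sequentially. 1 - real k / real x = real (x - k) / real x"
      using eventually_ge_at_top[of "Suc k"]
      by eventually_elim (auto simp: of_nat_diff field_simps)
  qed
  then have lim: "(\<lambda>n. real (N n $ l - k) / real (N n $ l)) \<longlonglongrightarrow> 1" for l
    using filterlim_compose assms by blast
  have "(\<lambda>n. 1 - (\<Prod>l\<in>UNIV. real (N n $ l - k) / real (N n $ l))) \<longlonglongrightarrow> 1 - (\<Prod>l\<in>(UNIV :: 'd set). 1)"
    by (intro tendsto_intros lim)
  then have "(\<lambda>n. 1 - (\<Prod>l\<in>UNIV. real (N n $ l - k) / real (N n $ l))) \<longlonglongrightarrow> 0" by simp
  moreover have "\<forall>\<^sub>F n in sequentially. \<forall>l. N n $ l > 0"
  proof (intro eventually_all_finite)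
    show "\<forall>\<^sub>F n in sequentially. N n $ l > 0" for l
      using eventually_compose_filterlim[OF eventually_gt_at_top[of 0] assms[of l]] .
  qed
  then have "\<forall>\<^sub>F n in sequentially. 1 - (\<Prod>l\<in>UNIV. real (N n $ l - k) / real (N n $ l)) =
      ((\<Prod>l\<in>UNIV. real (N n $ l)) - (\<Prod>l\<in>UNIV. real (N n $ l - k))) / (\<Prod>l\<in>UNIV. real (N n $ l))"
  proof eventually_elim
    case (elim n)
    then have "(\<Prod>l\<in>UNIV. real (N n $ l)) \<noteq> 0" by auto
    then show ?case by (simp add: prod_dividef diff_divide_distrib)
  qed
  ultimately show ?thesis by (rule Lim_transform_eventually)
qed

section \<open>The asymptotics along the given boxes\<close>

theorem mainTheorem4:
  fixes M :: "'a measure"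
    and X :: "int ^ 'd \<Rightarrow> 'a \<Rightarrow> real"
    and m :: nat
    and r :: "(int ^ 'd) rel"
    and N :: "nat \<Rightarrow> nat ^ 'd"
    and v :: "nat \<Rightarrow> real"
  assumes "random_field M X"
    and "stationary M X"
    and "m_dependent M m X"
    and "linear_order r"
    and "translation_invariant r"
    and "\<And>l. filterlim (\<lambda>n. N n $ l) at_top sequentially"
    and "(\<lambda>n. real (\<Prod>l\<in>UNIV. N n $ l)) \<sim>[sequentially] (\<lambda>n. real n ^ CARD('d))"
    and "liminf (\<lambda>n. ereal (\<P>(\<omega> in M. box_max X (N n) \<omega> \<le> ereal (v n)))) > 0"
  shows "(\<lambda>n. \<P>(\<omega> in M. box_max X (N n) \<omega> \<le> ereal (v n)) -
           exp (- (real n ^ CARD('d) *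
             \<P>(\<omega> in M. X 0 \<omega> > v n \<and> field_max X (A_set r (vec m)) \<omega> \<le> ereal (v n)))))
         \<in> o[sequentially](\<lambda>_. 1 :: real)"
proof -
  interpret stationary_m_dependent_field M X m
    using assms by unfold_locales
  let ?A = "A_set r (vec m)"
  define T where "T = (\<lambda>n. {1..int_vec (N n)})"
  define L where "L = (\<lambda>n. real (card (T n)))"
  define D where "D = (\<lambda>n. real n ^ CARD('d))"
  define q where "q = (\<lambda>n. tail (v n))"
  define P where "P = (\<lambda>n. prob (exceed_event (v n) {} (T n)))"
  define \<beta> where "\<beta> = (\<lambda>n. prob (exceed_event (v n) {0} ?A))"
  define C where "C = real (card (neighbourhood (2 * m) (0 :: int ^ 'd)))"
  define \<rho> where "\<rho> = (\<lambda>n. ((\<Prod>l\<in>UNIV. real (N n $ l)) - (\<Prod>l\<in>UNIV. real (N n $ l - 2 * m))) /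
    (\<Prod>l\<in>UNIV. real (N n $ l)))"
  have finT: "finite (T n)" for n unfolding T_def by (rule finite_vec_interval)
  have L_eq: "L n = (\<Prod>l\<in>UNIV. real (N n $ l))" for n by (simp add: L_def T_def card_box)
  have P_eq: "\<P>(\<omega> in M. box_max X (N n) \<omega> \<le> ereal (v n)) = P n" for n
    by (simp add: P_def exceed_event_def T_def box_max_def field_max_le_iff)
  have \<beta>_eq: "\<P>(\<omega> in M. X 0 \<omega> > v n \<and> field_max X ?A \<omega> \<le> ereal (v n)) = \<beta> n" for n
    by (simp add: \<beta>_def exceed_event_def field_max_le_iff)
  have q: "0 \<le> q n" "q n \<le> 1" for n unfolding q_def by (rule tail_bounds)+
  have \<beta>: "0 \<le> \<beta> n" "\<beta> n \<le> q n" for n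
    using prob_exceed_event_mono[of "{0}" "{0}" "{}" ?A "v n"] finite_A_set[of r "vec m"]
    by (auto simp: \<beta>_def q_def tail_def)
  \<comment> \<open>Any real strictly between 0 and the lower limit serves as
    \<open>a\<close>.\<close>
  obtain a where a: "0 < a" "\<forall>\<^sub>F n in sequentially. a \<le> P n"
  proof -
    obtain a where "0 < ereal a" "ereal a < liminf (\<lambda>n. ereal (P n))"
      using ereal_dense2[of 0] assms(8) unfolding P_eq by blast
    then have "0 < a" "\<forall>\<^sub>F n in sequentially. ereal a < ereal (P n)"
      using less_LiminfD[of "ereal a" sequentially "\<lambda>n. ereal (P n)"] by auto
    then show ?thesis by (intro that[of a]) (auto elim!: eventually_mono)
  qed
  define K where "K = real (card (neighbourhood m (0 :: int ^ 'd))) * (1 - ln a)"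
  have Lq: "\<forall>\<^sub>F n in sequentially. L n * q n \<le> K"
    using a(2) by eventually_elim
      (auto simp: L_def q_def K_def P_def intro!: card_tail_le finT a(1))
  have LD: "L \<sim>[sequentially] D"
    using assms(7) unfolding D_def by (simp add: L_eq[abs_def])
  have D_top: "filterlim D at_top sequentially"
    unfolding D_def by (intro filterlim_pow_at_top filterlim_real_sequentially) simp
  have L_top: "filterlim L at_top sequentially"
    using asymp_equiv_at_top_transfer[OF asymp_equiv_symI[OF LD] D_top] .
  have L_pos: "\<forall>\<^sub>F n in sequentially. L n > 0"
    using L_top by (simp add: filterlim_at_top_dense)
  have DL: "(\<lambda>n. D n / L n) \<longlonglongrightarrow> 1"
    by (intro asymp_equivD_strong[OF asymp_equiv_symI[OF LD]] eventually_mono[OF L_pos]) simp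
  have \<rho>: "\<rho> \<longlonglongrightarrow> 0"
    unfolding \<rho>_def by (rule prod_diff_ratio_tendsto[OF assms(6)])
  \<comment> \<open>The number of sites tends to infinity while \<open>L n * q n\<close> stays
    bounded.\<close>
  have q_lim: "q \<longlonglongrightarrow> 0"
  proof (rule tendsto_sandwich[of "\<lambda>_. 0" q _ "\<lambda>n. K / L n"])
    show "\<forall>\<^sub>F n in sequentially. q n \<le> K / L n"
      using Lq L_pos by eventually_elim (simp add: field_simps)
    show "(\<lambda>n. K / L n) \<longlonglongrightarrow> 0"
      using L_top by (intro tendsto_divide_0[OF tendsto_const] filterlim_at_top_imp_at_infinity)
  qed (use q in auto)
  \<comment> \<open>The terms are, in order: decoupling errors, boundary errors, passing from the
    power to \<open>exp (- (L n * \<beta> n))\<close>, and replacing \<open>L n\<close> by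
    \<open>D n\<close> in the exponent.\<close>
  define \<epsilon> where "\<epsilon> = (\<lambda>n. 2 * C * K * q n + 2 * K * \<rho> n + K * q n + K * \<bar>1 - D n / L n\<bar>)"
  have "\<epsilon> \<longlonglongrightarrow> 2 * C * K * 0 + 2 * K * 0 + K * 0 + K * \<bar>1 - 1\<bar>"
    unfolding \<epsilon>_def by (intro tendsto_intros q_lim \<rho> DL)
  then have \<epsilon>: "\<epsilon> \<longlonglongrightarrow> 0" by simp
  have "\<forall>\<^sub>F n in sequentially. norm (P n - exp (- (D n * \<beta> n))) \<le> \<epsilon> n"
    using Lq L_pos
  proof eventually_elim
    case (elim n)
    let ?bad = "real (card {i \<in> T n. \<not> (\<lambda>j. j + i) ` ?A \<subseteq> T n})"
    have sq: "L n * q n ^ 2 \<le> K * q n"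
      using mult_right_mono[OF elim(1) q(1)[of n]] by (simp add: power2_eq_square mult.assoc)
    have "?bad \<le> \<rho> n * L n"
    proof -
      have "?bad \<le> (\<Prod>l\<in>UNIV. real (N n $ l)) - (\<Prod>l\<in>UNIV. real (N n $ l - 2 * m))"
        unfolding T_def by (rule card_box_boundary_le) (simp add: A_set_vec)
      also have "\<dots> = \<rho> n * L n" using elim(2) unfolding \<rho>_def L_eq
        by (metis less_irrefl nonzero_eq_divide_eq)
      finally show ?thesis .
    qed
    then have "?bad * q n \<le> \<rho> n * (L n * q n)"
      using q(1)[of n] by (simp add: mult_right_mono mult.assoc[symmetric])
    moreover have "0 \<le> \<rho> n"
      unfolding \<rho>_def by (intro divide_nonneg_nonneg prod_nonneg) (auto intro!: prod_mono)
    then have "\<rho> n * (L n * q n) \<le> \<rho> n * K" using elim(1) by (rule mult_left_mono[rotated])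
    ultimately have bad: "?bad * q n \<le> K * \<rho> n" by (simp add: mult.commute)
    have "\<bar>P n - (1 - \<beta> n) ^ card (T n)\<bar> \<le> 2 * C * (L n * q n ^ 2) + 2 * (?bad * q n)"
      using prob_no_exceed_approx[OF assms(4,5) finT[of n], where c = "v n"]
      by (simp add: P_def \<beta>_def C_def L_def q_def algebra_simps)
    also have "\<dots> \<le> 2 * C * (K * q n) + 2 * (K * \<rho> n)"
      using sq bad by (intro add_mono mult_left_mono) (auto simp: C_def)
    finally have 1: "\<bar>P n - (1 - \<beta> n) ^ card (T n)\<bar> \<le> 2 * C * (K * q n) + 2 * (K * \<rho> n)" .
    have "\<bar>(1 - \<beta> n) ^ card (T n) - exp (- (L n * \<beta> n))\<bar> \<le> L n * \<beta> n ^ 2"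
      using power_one_minus_approx_exp[of "\<beta> n" "card (T n)"] \<beta>[of n] q[of n]
      by (simp add: L_def)
    also have "\<dots> \<le> L n * q n ^ 2"
      using \<beta>[of n] elim(2) by (intro mult_left_mono power_mono) auto
    finally have 2: "\<bar>(1 - \<beta> n) ^ card (T n) - exp (- (L n * \<beta> n))\<bar> \<le> K * q n"
      using sq by linarith
    have "\<bar>exp (- (L n * \<beta> n)) - exp (- (D n * \<beta> n))\<bar> \<le> \<bar>L n * \<beta> n - D n * \<beta> n\<bar>"
      using elim(2) \<beta>[of n] by (intro abs_exp_minus_diff_le) (auto simp: D_def)
    \<comment> \<open>The relative error is factored out because \<open>L n - D n\<close> itself
      need not be bounded, whereas \<open>L n * \<beta> n\<close> is at most
      \<open>K\<close>.\<close>
    also have "L n * \<beta> n - D n * \<beta> n = (1 - D n / L n) * (L n * \<beta> n)"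
      using elim(2) by (simp add: field_simps)
    also have "\<bar>\<dots>\<bar> = \<bar>1 - D n / L n\<bar> * (L n * \<beta> n)"
      using elim(2) \<beta>[of n] by (simp add: abs_mult)
    also have "\<dots> \<le> \<bar>1 - D n / L n\<bar> * K"
    proof (rule mult_left_mono)
      show "L n * \<beta> n \<le> K"
        using elim \<beta>[of n] mult_left_mono[of "\<beta> n" "q n" "L n"] by linarith
    qed simp
    finally show ?case
      using 1 2 unfolding \<epsilon>_def real_norm_def by (simp add: algebra_simps)
  qed
  then have "(\<lambda>n. P n - exp (- (D n * \<beta> n))) \<longlonglongrightarrow> 0"
    using \<epsilon> by (rule Lim_null_comparison)
  then show ?thesis
    unfolding P_eq \<beta>_eq by (intro smalloI_tendsto) (auto simp: D_def)
qed

end
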